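(* Let $j\ge 1$ and let $n_1,\ldots,n_j,k$ be nonnegative integers such that $n_j\le\cdots\le n_1$ and $k\le n_1+\cdots+n_j$. Then $$\left(\prod_{i=2}^{j}\binom{n_{i-1}}{n_i}_q\right)\binom{n_1+\cdots+n_j}{k}_q = \sum_{k_1+\cdots+k_j=k} q^{f(K)}\binom{n_1}{k_1}_q\prod_{i=2}^{j}\binom{n_{i-1}}{n_{i-1}-n_i,\ n_i-k_i,\ k_i}_q,$$ where the sum is over all $j$-tuples $K=(k_1,\ldots,k_j)$ of integers with $0\le k_i\le n_i$ for every $i$ and $k_1+\cdots+k_j=k$, and where $$f(K)=\sum_{u=1}^{j-1} k_u\Big(\sum_{i=u+1}^{j}(n_i-k_i)\Big).$$
   Context: $[n]=\{1,\ldots,n\}$ and $q$ is an indeterminate. Empty sums are $0$ and empty products are $1$. $q$-binomial coefficients: for nonnegative integers $n\ge k$, $\binom{n}{k}_q := \sum_{E\subseteq [n],\,|E|=k} q^{\sum_{i=1}^k ((n-e_i)-(k-i))}$, where $E=\{e_1<\cdots<e_k\}$. $q$-multinomial coefficients: for nonnegative integers with $k_1+\cdots+k_m=n$, $\binom{n}{k_1,\ldots,k_m}_q := \binom{n}{k_m}_q\binom{n-k_m}{k_{m-1}}_q\cdots\binom{n-k_m-\cdots-k_2}{k_1}_q$. *)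

theory Defs
  imports "HOL-Computational_Algebra.Polynomial" "HOL-Library.FuncSet"
begin

text \<open>The indeterminate of \<open>\<int>[q]\<close>, in which all identities take place.\<close>

abbreviation q_var :: "int poly" where
  "q_var \<equiv> [:0, 1:]"

text \<open>
  For \<open>E = {e\<^sub>1 < \<dots> < e\<^sub>k}\<close>, the element \<open>e\<^sub>i\<close> is entry \<open>i - 1\<close> of \<open>sorted_list_of_set E\<close>.
  No subtraction truncates: the \<open>k - i\<close> elements above \<open>e\<^sub>i\<close> lie in \<open>{e\<^sub>i<..n}\<close>,
  so \<open>k - i \<le> n - e\<^sub>i\<close>.
\<close>

definition q_binomial :: "nat \<Rightarrow> nat \<Rightarrow> int poly" where
  "q_binomial n k =
    (\<Sum>E | E \<subseteq> {1..n} \<and> card E = k.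
       q_var ^ (\<Sum>i=1..k. (n - sorted_list_of_set E ! (i - 1)) - (k - i)))"

text \<open>
  Meant for \<open>n = sum_list ks\<close>. With \<open>ks = [k\<^sub>1, \<dots>, k\<^sub>m]\<close>, the factor at position \<open>i\<close> is
  \<open>q_binomial (n - k\<^sub>m - \<dots> - k\<^sub>i\<^sub>+\<^sub>2) k\<^sub>i\<^sub>+\<^sub>1\<close>, as list positions count from \<open>0\<close>.
\<close>

definition q_multinomial :: "nat \<Rightarrow> nat list \<Rightarrow> int poly" where
  "q_multinomial n ks =
    (\<Prod>i<length ks. q_binomial (n - sum_list (drop (Suc i) ks)) (ks ! i))"

text \<open>Tuples indexed by \<open>{1..j}\<close>, as extensional functions so that each tuple occurs once.\<close>

definition bounded_tuples :: "nat \<Rightarrow> (nat \<Rightarrow> nat) \<Rightarrow> nat \<Rightarrow> (nat \<Rightarrow> nat) set" where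
  "bounded_tuples j n k = {K \<in> (\<Pi>\<^sub>E i\<in>{1..j}. {0..n i}). (\<Sum>i=1..j. K i) = k}"

definition q_exponent :: "nat \<Rightarrow> (nat \<Rightarrow> nat) \<Rightarrow> (nat \<Rightarrow> nat) \<Rightarrow> nat" where
  "q_exponent j n K = (\<Sum>u=1..j - 1. K u * (\<Sum>i=u + 1..j. n i - K i))"

end

theory Submission
  imports Defs
begin

text \<open>
  The proof separates two phenomena.

  The \<open>q\<close>-Vandermonde identity expresses the single coefficient on the left through smaller ones:
  cut \<open>{1..n\<^sub>1 + \<dots> + n\<^sub>j}\<close> into consecutive blocks of sizes \<open>n\<^sub>1, \<dots>, n\<^sub>j\<close>. A \<open>k\<close>-subset \<open>E\<close> is weighted
  by the number of pairs \<open>e < f\<close> with \<open>e \<in> E\<close> and \<open>f \<notin> E\<close>. If \<open>E\<close> has \<open>k\<^sub>i\<close> elements in block \<open>i\<close>,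
  the pairs inside a block contribute the weights counted by \<open>q_binomial n\<^sub>i k\<^sub>i\<close>, and
  the pairs with \<open>e\<close> in block \<open>u\<close> and \<open>f\<close> in a later block \<open>i\<close> number \<open>k\<^sub>u (n\<^sub>i - k\<^sub>i)\<close>, which add up to
  \<open>q_exponent\<close>. This is \<open>q_vandermonde_tuples\<close>; it is obtained by adding one block at a time to the
  two-block identity \<open>q_vandermonde\<close>, which in turn follows from the \<open>q\<close>-Pascal rule.

  For fixed \<open>K\<close>, each remaining factor \<open>q_binomial n\<^sub>i\<^sub>-\<^sub>1 n\<^sub>i\<close> is then absorbed by
  \<open>q_binomial n\<^sub>i k\<^sub>i\<close>: choosing \<open>n\<^sub>i\<close> out of \<open>n\<^sub>i\<^sub>-\<^sub>1\<close> and then \<open>k\<^sub>i\<close> out of those is counted by the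
  trinomial coefficient (\<open>q_trinomial_revision\<close>). That identity is read off from
  the factorial formula, which again follows from the \<open>q\<close>-Pascal rule.
\<close>

section \<open>Weights of subsets and the Pascal rule\<close>

text \<open>Powers of the indeterminate are kept as such instead of being evaluated to coefficient lists.\<close>

declare mult_pCons_left [simp del] mult_pCons_right [simp del]

text \<open>
  The gaps between the entries show that the subtractions in the weight of a set
  do not truncate, so that enlarging \<open>n\<close> by one raises each summand by exactly one.
\<close>

lemma nth_strict_sorted_le:
  fixes xs :: "nat list"
  assumes "sorted xs" "distinct xs" "set xs \<subseteq> {..n}" "i < length xs"
  shows "xs ! i + (length xs - Suc i) \<le> n"
proof -
  have "xs ! i + d \<le> xs ! (i + d)" if "i + d < length xs" for d
    using that
  proof (induction d)
    case (Suc d)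
    have "xs ! (i + d) < xs ! Suc (i + d)"
      using Suc.prems assms(1,2)
      by (metis Suc_lessD add_Suc_right lessI sorted_wrt_nth_less strict_sorted_iff)
    then show ?case using Suc by simp
  qed simp
  from this[of "length xs - Suc i"] have "xs ! i + (length xs - Suc i) \<le> xs ! (length xs - 1)"
    using assms(4) by simp
  moreover have "xs ! (length xs - 1) \<in> set xs"
    using assms(4) by (intro nth_mem) simp
  ultimately show ?thesis using assms(3) by force
qed

definition subset_weight :: "nat \<Rightarrow> nat \<Rightarrow> nat set \<Rightarrow> nat" where
  "subset_weight n k E = (\<Sum>i=1..k. (n - sorted_list_of_set E ! (i - 1)) - (k - i))"

lemma subset_weight_Suc:
  assumes "E \<subseteq> {1..n}" "card E = k"
  shows "subset_weight (Suc n) k E = k + subset_weight n k E"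
proof -
  let ?xs = "sorted_list_of_set E"
  have fin: "finite E" using assms(1) finite_subset by blast
  have len: "length ?xs = k" using assms(2) by simp
  have "(Suc n - ?xs ! (i - 1)) - (k - i) = Suc ((n - ?xs ! (i - 1)) - (k - i))"
    if "i \<in> {1..k}" for i
  proof -
    have "?xs ! (i - 1) + (length ?xs - Suc (i - 1)) \<le> n"
      using that len fin assms(1) by (intro nth_strict_sorted_le) auto
    then show ?thesis using that len by auto
  qed
  then show ?thesis unfolding subset_weight_def by (simp add: sum.distrib sum_Suc)
qed

lemma subset_weight_insert_Suc:
  assumes "E \<subseteq> {1..n}" "card E = k"
  shows "subset_weight (Suc n) (Suc k) (insert (Suc n) E) = subset_weight n k E"
proof -
  let ?xs = "sorted_list_of_set E"
  have fin: "finite E" using assms(1) finite_subset by blast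
  have len: "length ?xs = k" using assms(2) by simp
  have "sorted (?xs @ [Suc n])" "distinct (?xs @ [Suc n])"
    using fin assms(1) by (auto simp: sorted_append)
  then have "sorted_list_of_set (set (?xs @ [Suc n])) = ?xs @ [Suc n]"
    using sorted_list_of_set.idem_if_sorted_distinct by blast
  then have eq: "sorted_list_of_set (insert (Suc n) E) = ?xs @ [Suc n]"
    using fin by simp
  have "(\<Sum>i=1..Suc k. (Suc n - (?xs @ [Suc n]) ! (i - 1)) - (Suc k - i))
      = (\<Sum>i=1..k. (Suc n - (?xs @ [Suc n]) ! (i - 1)) - (Suc k - i))"
    using len by (simp add: nth_append)
  also have "\<dots> = (\<Sum>i=1..k. (n - ?xs ! (i - 1)) - (k - i))"
    using len by (intro sum.cong) (auto simp: nth_append)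
  finally show ?thesis unfolding subset_weight_def eq .
qed

lemma q_binomial_eq_sum_weight:
  "q_binomial n k = (\<Sum>E | E \<subseteq> {1..n} \<and> card E = k. q_var ^ subset_weight n k E)"
  unfolding q_binomial_def subset_weight_def ..

lemma q_binomial_0_right [simp]: "q_binomial n 0 = 1"
proof -
  have "{E. E \<subseteq> {1..n} \<and> card E = 0} = {{}}"
    using finite_subset by fastforce
  then show ?thesis unfolding q_binomial_def by simp
qed

lemma q_binomial_eq_0: "n < k \<Longrightarrow> q_binomial n k = 0"
proof -
  assume "n < k"
  then have "{E. E \<subseteq> {1..n} \<and> card E = k} = {}"
    by (auto dest: card_mono[rotated])
  then show ?thesis unfolding q_binomial_def by (simp only: sum.empty)
qed

text \<open>
  Split by whether the top point \<open>n + 1\<close> is chosen. If so, nothing lies above it and no weight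
  changes; if not, it is a new unchosen point above each of the \<open>k + 1\<close> chosen ones.
\<close>

lemma q_binomial_Suc_Suc:
  "q_binomial (Suc n) (Suc k) = q_binomial n k + q_var ^ Suc k * q_binomial n (Suc k)"
proof -
  define S where "S = (\<lambda>k. {E. E \<subseteq> {1..n} \<and> card E = k})"
  have fin: "finite (S k)" for k
    unfolding S_def by (rule finite_subset[of _ "Pow {1..n}"]) auto
  have finE: "finite E" if "E \<in> S k" for E k
    using that finite_subset unfolding S_def by blast
  have inj: "inj_on (insert (Suc n)) (S k)"
    by (rule inj_on_inverseI[where g = "\<lambda>E. E - {Suc n}"]) (auto simp: S_def)
  have split: "{E. E \<subseteq> {1..Suc n} \<and> card E = Suc k} = insert (Suc n) ` S k \<union> S (Suc k)"
  proof (intro set_eqI iffI)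
    fix E assume E: "E \<in> {E. E \<subseteq> {1..Suc n} \<and> card E = Suc k}"
    show "E \<in> insert (Suc n) ` S k \<union> S (Suc k)"
    proof (cases "Suc n \<in> E")
      case True
      then have "E = insert (Suc n) (E - {Suc n})" by blast
      moreover have "E - {Suc n} \<in> S k"
        using E True unfolding S_def by (auto simp: le_Suc_eq)
      ultimately show ?thesis by blast
    next
      case False
      then show ?thesis using E unfolding S_def by (auto simp: le_Suc_eq dest!: subsetD)
    qed
  next
    fix E assume "E \<in> insert (Suc n) ` S k \<union> S (Suc k)"
    then show "E \<in> {E. E \<subseteq> {1..Suc n} \<and> card E = Suc k}"
    proof
      assume "E \<in> insert (Suc n) ` S k"
      then obtain F where F: "F \<in> S k" "E = insert (Suc n) F" by blast
      have "Suc n \<notin> F" using F(1) unfolding S_def by auto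
      then show ?thesis using F finE[OF F(1)] unfolding S_def by auto
    qed (auto simp: S_def)
  qed
  have "q_binomial (Suc n) (Suc k) =
      (\<Sum>E\<in>insert (Suc n) ` S k. q_var ^ subset_weight (Suc n) (Suc k) E)
      + (\<Sum>E\<in>S (Suc k). q_var ^ subset_weight (Suc n) (Suc k) E)"
    unfolding q_binomial_eq_sum_weight split
    by (rule sum.union_disjoint) (use fin in \<open>auto simp: S_def\<close>)
  also have "(\<Sum>E\<in>insert (Suc n) ` S k. q_var ^ subset_weight (Suc n) (Suc k) E) = q_binomial n k"
    unfolding sum.reindex[OF inj] q_binomial_eq_sum_weight
    by (rule sum.cong) (auto simp: S_def subset_weight_insert_Suc)
  also have "(\<Sum>E\<in>S (Suc k). q_var ^ subset_weight (Suc n) (Suc k) E)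
      = q_var ^ Suc k * q_binomial n (Suc k)"
    unfolding q_binomial_eq_sum_weight sum_distrib_left
    by (rule sum.cong) (auto simp only: S_def subset_weight_Suc power_add mem_Collect_eq)
  finally show ?thesis .
qed

lemma q_binomial_self [simp]: "q_binomial n n = 1"
  by (induction n) (simp_all add: q_binomial_Suc_Suc q_binomial_eq_0 del: power_Suc)

section \<open>The factorial formula and trinomial revision\<close>

definition q_number :: "nat \<Rightarrow> int poly" where
  "q_number n = (\<Sum>i<n. q_var ^ i)"

definition q_factorial :: "nat \<Rightarrow> int poly" where
  "q_factorial n = (\<Prod>i=1..n. q_number i)"

lemma q_factorial_0 [simp]: "q_factorial 0 = 1"
  by (simp add: q_factorial_def)

lemma q_factorial_Suc: "q_factorial (Suc n) = q_factorial n * q_number (Suc n)"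
  by (simp add: q_factorial_def)

lemma q_number_add: "q_number (m + n) = q_number m + q_var ^ m * q_number n"
  by (induction n) (simp_all add: q_number_def algebra_simps power_add)

text \<open>At \<open>q = 1\<close> a \<open>q\<close>-number becomes an ordinary positive number, so \<open>q\<close>-factorials can be cancelled.\<close>

lemma q_factorial_nonzero: "q_factorial n \<noteq> 0"
proof -
  have "poly (q_number i) 1 = int i" for i
    by (simp add: q_number_def poly_sum)
  then have "poly (q_factorial n) 1 \<noteq> 0"
    by (simp add: q_factorial_def poly_prod)
  then show ?thesis by force
qed

text \<open>
  In the inductive step the \<open>q\<close>-Pascal rule splits the left side into \<open>q_factorial (k + m - 1)\<close> times
  \<open>q_number k\<close> and the same times \<open>q_var ^ k * q_number m\<close>; by \<open>q_number_add\<close> the two multipliers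
  add up to \<open>q_number (k + m)\<close>.
\<close>

lemma q_binomial_factorial:
  "q_binomial (k + m) k * (q_factorial k * q_factorial m) = q_factorial (k + m)"
proof (induction "k + m" arbitrary: k m)
  case (Suc N)
  show ?case
  proof (cases "k = 0 \<or> m = 0")
    case False
    then obtain k' m' where km: "k = Suc k'" "m = Suc m'"
      by (metis not0_implies_Suc)
    have 1: "q_binomial (k' + m) k' * (q_factorial k' * q_factorial m) = q_factorial (k' + m)"
      using Suc(1)[of k' m] Suc(2) km by simp
    have 2: "q_binomial (k + m') k * (q_factorial k * q_factorial m') = q_factorial (k' + m)"
      using Suc(1)[of k m'] Suc(2) km by simp
    have "q_binomial (k + m) k * (q_factorial k * q_factorial m)
      = q_binomial (k' + m) k' * (q_factorial k' * q_factorial m) * q_number k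
        + q_var ^ k * (q_binomial (k + m') k * (q_factorial k * q_factorial m') * q_number m)"
      unfolding km by (simp add: q_binomial_Suc_Suc q_factorial_Suc algebra_simps del: power_Suc)
    also have "\<dots> = q_factorial (k' + m) * q_number (k + m)"
      unfolding 1 2 q_number_add by (simp add: algebra_simps)
    also have "\<dots> = q_factorial (k + m)"
      using q_factorial_Suc[of "k' + m"] km by simp
    finally show ?thesis .
  qed auto
qed simp

text \<open>
  Choosing an \<open>m\<close>-set and then an \<open>l\<close>-set inside it, or choosing the \<open>l\<close>-set first and then
  the other \<open>m - l\<close> elements, both give \<open>q_factorial n\<close> divided by the \<open>q\<close>-factorials of the three parts.
  The order of the parts leaves the factor for \<open>n - m\<close> as \<open>q_binomial (n - m) (n - m) = 1\<close>.
\<close>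

lemma q_trinomial_revision:
  assumes "l \<le> m" "m \<le> n"
  shows "q_multinomial n [n - m, m - l, l] = q_binomial n m * q_binomial m l"
proof -
  obtain b where b: "m = l + b" using assms(1) le_Suc_ex by blast
  obtain a where a: "n = l + b + a" using assms(2) b le_Suc_ex by blast
  let ?F = "q_factorial l * q_factorial b * q_factorial a"
  have revision: "q_binomial (b + a) b * q_binomial n l = q_binomial n m * q_binomial m l"
  proof -
    have "q_binomial (b + a) b * q_binomial n l * ?F = q_factorial n"
      using q_binomial_factorial[of l "b + a"]
      unfolding a q_binomial_factorial[of b a, symmetric] by (simp only: ac_simps)
    moreover have "q_binomial n m * q_binomial m l * ?F = q_factorial n"
      using q_binomial_factorial[of "l + b" a]
      unfolding a b q_binomial_factorial[of l b, symmetric] by (simp only: ac_simps)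
    moreover have "?F \<noteq> 0" using q_factorial_nonzero by simp
    ultimately show ?thesis by (metis mult_right_cancel)
  qed
  have "q_multinomial n [n - m, m - l, l]
      = q_binomial a a * (q_binomial (b + a) b * q_binomial n l)"
    by (simp add: q_multinomial_def numeral_3_eq_3 a b ac_simps)
  then show ?thesis using revision by simp
qed

section \<open>The Vandermonde identity\<close>

text \<open>
  The induction adds one point at the top of the second block. The boundary cases are consistent
  with truncated subtraction, since \<open>q_binomial n l = 0\<close> for \<open>l > n\<close>.
\<close>

lemma q_vandermonde:
  "q_binomial (m + n) k =
    (\<Sum>l\<le>k. q_var ^ ((k - l) * (n - l)) * q_binomial m (k - l) * q_binomial n l)"
proof (induction n arbitrary: k)
  case 0
  have "(\<Sum>l\<le>k. q_var ^ ((k - l) * (0 - l)) * q_binomial m (k - l) * q_binomial 0 l)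
      = (\<Sum>l\<le>k. if l = 0 then q_binomial m k else 0)"
    by (rule sum.cong) (auto simp: q_binomial_eq_0)
  then show ?case by simp
next
  case (Suc n)
  show ?case
  proof (cases k)
    case 0
    then show ?thesis by simp
  next
    case (Suc k')
    let ?T = "\<lambda>k l. q_var ^ ((k - l) * (n - l)) * q_binomial m (k - l) * q_binomial n l"
    let ?U = "\<lambda>l. q_var ^ ((k - l) * (Suc n - l)) * q_binomial m (k - l) * q_binomial (Suc n) l"
    have head: "?U 0 = q_var ^ k * ?T k 0"
      by (simp add: power_add)
    \<comment> \<open>The power of \<open>q\<close> in the Pascal rule for \<open>q_binomial (n + 1) (l + 1)\<close> and the growth of
      \<open>(k - l - 1) * (n - l - 1)\<close> combine to the constant factor \<open>q_var ^ k\<close>.\<close>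
    have step: "?U (Suc l) = ?T k' l + q_var ^ k * ?T k (Suc l)" if le: "l \<le> k'" for l
    proof (cases "Suc l \<le> n")
      case True
      then obtain d where d: "n = Suc l + d" using le_Suc_ex by blast
      obtain c where c: "k' = l + c" using le le_Suc_ex by blast
      show ?thesis unfolding Suc d c
        by (simp add: q_binomial_Suc_Suc power_add algebra_simps)
    next
      case False
      then show ?thesis unfolding Suc by (simp add: q_binomial_Suc_Suc q_binomial_eq_0)
    qed
    have "(\<Sum>l\<le>k. ?U l) = ?U 0 + (\<Sum>l\<le>k'. ?U (Suc l))"
      unfolding Suc by (rule sum.atMost_Suc_shift)
    also have "\<dots> = q_var ^ k * ?T k 0 + (\<Sum>l\<le>k'. ?T k' l + q_var ^ k * ?T k (Suc l))"
      unfolding head using step by (intro arg_cong2[of _ _ _ _ "(+)"] sum.cong) auto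
    also have "\<dots> = (\<Sum>l\<le>k'. ?T k' l) + q_var ^ k * (?T k 0 + (\<Sum>l\<le>k'. ?T k (Suc l)))"
      by (simp only: sum.distrib sum_distrib_left distrib_left ac_simps)
    also have "?T k 0 + (\<Sum>l\<le>k'. ?T k (Suc l)) = (\<Sum>l\<le>k. ?T k l)"
      unfolding Suc by (rule sum.atMost_Suc_shift[symmetric])
    also have "(\<Sum>l\<le>k'. ?T k' l) + q_var ^ k * (\<Sum>l\<le>k. ?T k l) = q_binomial (m + Suc n) k"
      unfolding Suc.IH[symmetric] using Suc by (simp add: q_binomial_Suc_Suc del: power_Suc)
    finally show ?thesis by simp
  qed
qed

lemma finite_bounded_tuples: "finite (bounded_tuples j n k)"
  unfolding bounded_tuples_def 
  by (rule finite_subset[of _ "\<Pi>\<^sub>E i\<in>{1..j}. {0..n i}"]) (auto intro: finite_PiE)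

text \<open>
  A tuple of length \<open>j + 1\<close> is a last entry \<open>l\<close> together with a tuple of length \<open>j\<close> summing
  to \<open>k - l\<close>; bounding \<open>l\<close> by \<open>k\<close> as well keeps this difference from truncating.
\<close>

lemma sum_bounded_tuples_Suc:
  "(\<Sum>K\<in>bounded_tuples (Suc j) n k. f K) =
    (\<Sum>l\<le>min k (n (Suc j)). \<Sum>K\<in>bounded_tuples j n (k - l). f (K(Suc j := l)))"
proof -
  have "(\<Sum>l\<le>min k (n (Suc j)). \<Sum>K\<in>bounded_tuples j n (k - l). f (K(Suc j := l)))
     = (\<Sum>(l, K)\<in>Sigma {..min k (n (Suc j))} (\<lambda>l. bounded_tuples j n (k - l)). f (K(Suc j := l)))"
    by (rule sum.Sigma) (auto simp: finite_bounded_tuples)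
  also have "\<dots> = (\<Sum>K\<in>bounded_tuples (Suc j) n k. f K)"
  proof (rule sum.reindex_bij_witness[where
        i = "\<lambda>K. (K (Suc j), K(Suc j := undefined))" and j = "\<lambda>(l, K). K(Suc j := l)"])
    fix p assume p: "p \<in> Sigma {..min k (n (Suc j))} (\<lambda>l. bounded_tuples j n (k - l))"
    obtain l K where lK: "p = (l, K)" by fastforce
    have l: "l \<le> k" "l \<le> n (Suc j)" and K: "K \<in> (\<Pi>\<^sub>E i\<in>{1..j}. {0..n i})"
      and s: "(\<Sum>i=1..j. K i) = k - l"
      using p lK unfolding bounded_tuples_def by auto
    have "K (Suc j) = undefined" using K by (auto simp: PiE_def extensional_def)
    then show "((case p of (l, K) \<Rightarrow> K(Suc j := l)) (Suc j),
        (case p of (l, K) \<Rightarrow> K(Suc j := l))(Suc j := undefined)) = p"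
      using lK by auto
    have "(\<Sum>i=1..Suc j. (K(Suc j := l)) i) = k"
      using s l by simp
    moreover have "K(Suc j := l) \<in> (\<Pi>\<^sub>E i\<in>{1..Suc j}. {0..n i})"
      using K l by (auto simp: PiE_def Pi_def extensional_def le_Suc_eq)
    ultimately show "(case p of (l, K) \<Rightarrow> K(Suc j := l)) \<in> bounded_tuples (Suc j) n k"
      using lK unfolding bounded_tuples_def by simp
  next
    fix K assume K: "K \<in> bounded_tuples (Suc j) n k"
    then have K1: "K \<in> (\<Pi>\<^sub>E i\<in>{1..Suc j}. {0..n i})" and s: "(\<Sum>i=1..j. K i) + K (Suc j) = k"
      unfolding bounded_tuples_def by auto
    have "K(Suc j := undefined) \<in> (\<Pi>\<^sub>E i\<in>{1..j}. {0..n i})"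
      using K1 by (auto simp: PiE_def Pi_def extensional_def le_Suc_eq)
    moreover have "K (Suc j) \<le> n (Suc j)" using K1 by (auto simp: PiE_def Pi_def)
    moreover have "(\<Sum>i=1..j. (K(Suc j := undefined)) i) = (\<Sum>i=1..j. K i)"
      by (rule sum.cong) auto
    ultimately show "(K (Suc j), K(Suc j := undefined))
        \<in> Sigma {..min k (n (Suc j))} (\<lambda>l. bounded_tuples j n (k - l))"
      using s unfolding bounded_tuples_def by auto
  qed auto
  finally show ?thesis by simp
qed

lemma q_exponent_Suc:
  "q_exponent (Suc j) n K = q_exponent j n K + (\<Sum>u=1..j. K u) * (n (Suc j) - K (Suc j))"
proof -
  let ?r = "\<lambda>u. \<Sum>i=u + 1..j. n i - K i"
  \<comment> \<open>The exponent may be summed up to \<open>u = j\<close>, as the inner sum is then empty.\<close>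
  have "(\<Sum>u=1..j. K u * ?r u) = q_exponent j n K"
    unfolding q_exponent_def by (cases j) auto
  moreover have "q_exponent (Suc j) n K
      = (\<Sum>u=1..j. K u * ?r u + K u * (n (Suc j) - K (Suc j)))"
    unfolding q_exponent_def by (auto intro!: sum.cong simp: distrib_left)
  ultimately show ?thesis
    by (simp add: sum.distrib sum_distrib_right)
qed

lemma q_exponent_cong:
  "(\<And>i. i \<in> {1..j} \<Longrightarrow> K i = L i) \<Longrightarrow> q_exponent j n K = q_exponent j n L"
  unfolding q_exponent_def by (intro sum.cong arg_cong2[of _ _ _ _ "(*)"]) auto

text \<open>
  Induction on the number of blocks: the first \<open>j\<close> blocks together form the lower block of
  \<open>q_vandermonde\<close>, and its factor \<open>q_var ^ ((k - l) * (n\<^sub>j\<^sub>+\<^sub>1 - l))\<close> is what the exponent gains.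
\<close>

lemma q_vandermonde_tuples:
  "q_binomial (\<Sum>i=1..j. n i) k =
    (\<Sum>K\<in>bounded_tuples j n k. q_var ^ q_exponent j n K * (\<Prod>i=1..j. q_binomial (n i) (K i)))"
proof (induction j arbitrary: k)
  case 0
  have "bounded_tuples 0 n k = (if k = 0 then {\<lambda>_. undefined} else {})"
    unfolding bounded_tuples_def by auto
  then show ?case by (auto simp: q_exponent_def q_binomial_eq_0)
next
  case (Suc j)
  let ?N = "n (Suc j)" and ?W = "\<lambda>j K. q_var ^ q_exponent j n K * (\<Prod>i=1..j. q_binomial (n i) (K i))"
  have block: "?W (Suc j) (K(Suc j := l))
      = q_var ^ ((k - l) * (?N - l)) * ?W j K * q_binomial ?N l"
    if K: "K \<in> bounded_tuples j n (k - l)" for K l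
  proof -
    let ?L = "K(Suc j := l)"
    have "(\<Sum>u=1..j. ?L u) = (\<Sum>u=1..j. K u)" by (rule sum.cong) auto
    also have "\<dots> = k - l" using K unfolding bounded_tuples_def by simp
    finally have "q_exponent (Suc j) n ?L = q_exponent j n K + (k - l) * (?N - l)"
      unfolding q_exponent_Suc using q_exponent_cong[of j ?L K n] by simp
    moreover have "(\<Prod>i=1..Suc j. q_binomial (n i) (?L i))
        = (\<Prod>i=1..j. q_binomial (n i) (K i)) * q_binomial ?N l"
      by (simp add: prod.nat_ivl_Suc')
    ultimately show ?thesis by (simp only: power_add ac_simps)
  qed
  have "q_binomial (\<Sum>i=1..Suc j. n i) k
      = (\<Sum>l\<le>k. q_var ^ ((k - l) * (?N - l)) * q_binomial (\<Sum>i=1..j. n i) (k - l) * q_binomial ?N l)"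
    using q_vandermonde by simp
  also have "\<dots> = (\<Sum>l\<le>min k ?N.
      q_var ^ ((k - l) * (?N - l)) * q_binomial (\<Sum>i=1..j. n i) (k - l) * q_binomial ?N l)"
    by (rule sum.mono_neutral_right) (auto simp: q_binomial_eq_0)
  also have "\<dots> = (\<Sum>l\<le>min k ?N. \<Sum>K\<in>bounded_tuples j n (k - l). ?W (Suc j) (K(Suc j := l)))"
  proof (rule sum.cong)
    fix l
    show "q_var ^ ((k - l) * (?N - l)) * q_binomial (\<Sum>i=1..j. n i) (k - l) * q_binomial ?N l
        = (\<Sum>K\<in>bounded_tuples j n (k - l). ?W (Suc j) (K(Suc j := l)))"
      unfolding Suc.IH sum_distrib_left sum_distrib_right
      by (rule sum.cong) (simp_all only: block)
  qed simp
  also have "\<dots> = (\<Sum>K\<in>bounded_tuples (Suc j) n k. ?W (Suc j) K)"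
    by (rule sum_bounded_tuples_Suc[symmetric])
  finally show ?case .
qed

section \<open>The identity for multinomial coefficients\<close>

theorem proposition2p11:
  fixes j k :: nat and n :: "nat \<Rightarrow> nat"
  assumes "j \<ge> 1"
    and "\<And>i. i \<in> {2..j} \<Longrightarrow> n i \<le> n (i - 1)"
    and "k \<le> (\<Sum>i=1..j. n i)"
  shows "(\<Prod>i=2..j. q_binomial (n (i - 1)) (n i)) * q_binomial (\<Sum>i=1..j. n i) k =
    (\<Sum>K\<in>bounded_tuples j n k.
       q_var ^ q_exponent j n K * q_binomial (n 1) (K 1) *
       (\<Prod>i=2..j. q_multinomial (n (i - 1)) [n (i - 1) - n i, n i - K i, K i]))"
  unfolding q_vandermonde_tuples sum_distrib_left
proof (rule sum.cong)
  fix K assume K: "K \<in> bounded_tuples j n k"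
  have "(\<Prod>i=2..j. q_multinomial (n (i - 1)) [n (i - 1) - n i, n i - K i, K i])
      = (\<Prod>i=2..j. q_binomial (n (i - 1)) (n i) * q_binomial (n i) (K i))"
  proof (rule prod.cong)
    fix i assume i: "i \<in> {2..j}"
    have "K i \<le> n i" using K i unfolding bounded_tuples_def by (auto simp: PiE_def Pi_def)
    then show "q_multinomial (n (i - 1)) [n (i - 1) - n i, n i - K i, K i]
        = q_binomial (n (i - 1)) (n i) * q_binomial (n i) (K i)"
      using assms(2)[OF i] by (rule q_trinomial_revision)
  qed simp
  moreover have "(\<Prod>i=1..j. q_binomial (n i) (K i))
      = q_binomial (n 1) (K 1) * (\<Prod>i=2..j. q_binomial (n i) (K i))"
    using prod.atLeast_Suc_atMost[OF assms(1)] by (simp add: numeral_2_eq_2)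
  ultimately show "(\<Prod>i=2..j. q_binomial (n (i - 1)) (n i)) *
        (q_var ^ q_exponent j n K * (\<Prod>i=1..j. q_binomial (n i) (K i)))
      = q_var ^ q_exponent j n K * q_binomial (n 1) (K 1) *
        (\<Prod>i=2..j. q_multinomial (n (i - 1)) [n (i - 1) - n i, n i - K i, K i])"
    by (simp only: prod.distrib ac_simps)
qed simp

end
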